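(* Let $X$ and $Y$ be non-empty subsets of $\mathbb{R}$, let $p$ be a positive integer, and let $K : X \times Y \to \mathbb{R}$ be a bounded $\mathrm{TN}_p$ kernel. Let $C$ be the set of points in the interior of $X \times Y$ (as a subset of $\mathbb{R}^2$) at which $K$ is continuous. Then there exists a sequence $(K_l)_{l \geq 1}$ of $\mathrm{TP}_p$ kernels on $X \times Y$ which converges to $K$ locally uniformly on $C$. Furthermore, if $X = Y$ and $K$ is symmetric, then the kernels $K_l$ may be taken to be symmetric.
   Context: For $p \in \mathbb{N}$ and $X, Y \subseteq \mathbb{R}$, a kernel $K : X \times Y \to \mathbb{R}$ is $\mathrm{TN}_p$ (respectively $\mathrm{TP}_p$) if for every $n \in \{1,\dots,p\}$ and all $x_1 < \cdots < x_n$ in $X$ and $y_1 < \cdots < y_n$ in $Y$ the determinant of $(K(x_i,y_j))_{i,j=1}^n$ is $\geq 0$ (respectively $> 0$). A kernel on $X \times X$ is symmetric if $K(x,y) = K(y,x)$ for all $x, y \in X$. Convergence locally uniformly on $C$ means uniform convergence on every compact subset of $C$. *)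

theory Defs
  imports "HOL-Analysis.Analysis" "Jordan_Normal_Form.Determinant"
begin

text \<open>
  A kernel on \<open>X \<times> Y\<close> is a function on \<open>real \<times> real\<close> of which only the values on
  \<open>X \<times> Y\<close> are used. Points and matrix entries are indexed from 0. The qualified names
  select the matrices of varying size from \<open>Jordan_Normal_Form\<close> rather than the
  type-indexed ones from \<open>HOL-Analysis\<close>.
\<close>

definition kernel_det :: "(real \<times> real \<Rightarrow> real) \<Rightarrow> nat \<Rightarrow> (nat \<Rightarrow> real) \<Rightarrow> (nat \<Rightarrow> real) \<Rightarrow> real" where
  "kernel_det K n x y = Determinant.det (Matrix.mat n n (\<lambda>(i, j). K (x i, y j)))"

definition increasing_points :: "real set \<Rightarrow> nat \<Rightarrow> (nat \<Rightarrow> real) \<Rightarrow> bool" where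
  "increasing_points X n x \<longleftrightarrow> x ` {..<n} \<subseteq> X \<and> strict_mono_on {..<n} x"

definition TN :: "nat \<Rightarrow> real set \<Rightarrow> real set \<Rightarrow> (real \<times> real \<Rightarrow> real) \<Rightarrow> bool" where
  "TN p X Y K \<longleftrightarrow>
    (\<forall>n\<in>{1..p}. \<forall>x y. increasing_points X n x \<longrightarrow> increasing_points Y n y \<longrightarrow> kernel_det K n x y \<ge> 0)"

definition TP :: "nat \<Rightarrow> real set \<Rightarrow> real set \<Rightarrow> (real \<times> real \<Rightarrow> real) \<Rightarrow> bool" where
  "TP p X Y K \<longleftrightarrow>
    (\<forall>n\<in>{1..p}. \<forall>x y. increasing_points X n x \<longrightarrow> increasing_points Y n y \<longrightarrow> kernel_det K n x y > 0)"

definition symmetric_kernel :: "real set \<Rightarrow> (real \<times> real \<Rightarrow> real) \<Rightarrow> bool" where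
  "symmetric_kernel X K \<longleftrightarrow> (\<forall>x\<in>X. \<forall>y\<in>X. K (x, y) = K (y, x))"

definition interior_continuity_points :: "real set \<Rightarrow> real set \<Rightarrow> (real \<times> real \<Rightarrow> real) \<Rightarrow> (real \<times> real) set" where
  "interior_continuity_points X Y K =
    {z \<in> interior (X \<times> Y). continuous (at z within X \<times> Y) K}"

definition converges_locally_uniformly_on ::
  "(real \<times> real) set \<Rightarrow> (nat \<Rightarrow> real \<times> real \<Rightarrow> real) \<Rightarrow> (real \<times> real \<Rightarrow> real) \<Rightarrow> bool" where
  "converges_locally_uniformly_on C Ks K \<longleftrightarrow>
    (\<forall>S. compact S \<and> S \<subseteq> C \<longrightarrow> uniform_limit S Ks K sequentially)"

end

(* Extending K by zero to the whole plane keeps it TN_p, so X = Y = R may be assumed. For large l,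
   sample K at the points t_i = i/l - l with t_i <= l and add p further points t_i > l, on which the
   sampled matrix is continued by the identity: the block sum A is TN_p and has positive minors of
   all orders up to p, whatever the rank of K. Smoothing A on both sides with the weights
   w_i(x) proportional to exp(-l (x - t_i)^2), a strictly totally positive system that is normalised
   to sum 1 and concentrates near x, gives by Cauchy-Binet a TP_p kernel that is close to K on
   compact sets of continuity points. Every step preserves symmetry. *)

theory Submission
  imports Defs "HOL-Real_Asymp.Real_Asymp"
begin

section \<open>Determinants of matrices given by entry functions\<close>

abbreviation fdet :: "nat \<Rightarrow> (nat \<Rightarrow> nat \<Rightarrow> real) \<Rightarrow> real" where
  "fdet n F \<equiv> Determinant.det (Matrix.mat n n (\<lambda>(i, j). F i j))"

lemma fdet_cong:
  assumes "\<And>i j. i < n \<Longrightarrow> j < n \<Longrightarrow> F i j = G i j"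
  shows "fdet n F = fdet n G"
  by (rule arg_cong[where f = Determinant.det]) (use assms in \<open>auto intro!: eq_matI\<close>)

lemma fdet_leibniz:
  "fdet n F = (\<Sum>\<pi> | \<pi> permutes {0..<n}. signof \<pi> * (\<Prod>i=0..<n. F i (\<pi> i)))"
proof -
  have "\<pi> i < n" if "\<pi> permutes {0..<n}" "i < n" for \<pi> i
    using permutes_in_image[OF that(1), of i] that(2) by simp
  then show ?thesis
    by (subst det_def'[of _ n]) (auto intro!: sum.cong prod.cong)
qed

lemma fdet_transpose: "fdet n (\<lambda>i j. F j i) = fdet n F"
  by (subst det_transpose[symmetric, of _ n]) (auto intro!: arg_cong[where f = Determinant.det] eq_matI)

lemma fdet_permute_rows:
  assumes "\<pi> permutes {0..<n}"
  shows "fdet n (\<lambda>i j. F (\<pi> i) j) = signof \<pi> * fdet n F"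
proof -
  have "fdet n (\<lambda>i j. F (\<pi> i) j) =
      Determinant.det (Matrix.mat n n (\<lambda>(i, j). Matrix.mat n n (\<lambda>(i, j). F i j) $$ (\<pi> i, j)))"
    using permutes_in_image[OF assms] by (intro fdet_cong) auto
  also have "\<dots> = signof \<pi> * fdet n F"
    by (rule det_permute_rows[OF _ assms]) auto
  finally show ?thesis .
qed

lemma fdet_identical_rows:
  assumes "i < n" "j < n" "i \<noteq> j" "\<And>k. k < n \<Longrightarrow> F i k = F j k"
  shows "fdet n F = 0"
  by (rule det_identical_rows[of _ n i j]) (use assms in \<open>auto intro!: eq_vecI\<close>)

lemma fdet_zero_row:
  assumes "i < n" "\<And>j. j < n \<Longrightarrow> F i j = 0"
  shows "fdet n F = 0"
  by (subst laplace_expansion_row[of _ n i]) (use assms in auto)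

lemma fdet_zero_col:
  assumes "j < n" "\<And>i. i < n \<Longrightarrow> F i j = 0"
  shows "fdet n F = 0"
  using fdet_zero_row[of j n "\<lambda>i j. F j i"] assms
  unfolding fdet_transpose[of n F] by simp

text \<open>The cofactors along the last row do not see that row, so one coefficient vector
  \<open>c\<close> serves every replacement \<open>r\<close>. This makes the determinant a linear
  form in its last row, with the leading minor as last coefficient.\<close>

lemma fdet_laplace_last_row:
  obtains c where "c n = fdet n F"
    and "\<forall>r. fdet (Suc n) (\<lambda>i j. if i = n then r j else F i j) = (\<Sum>j<Suc n. c j * r j)"
proof -
  define c where "c j = cofactor (Matrix.mat (Suc n) (Suc n) (\<lambda>(i, j). F i j)) n j" for j
  have "c n = fdet n F"
    unfolding c_def cofactor_def mat_delete_def
    by (auto intro!: arg_cong[where f = Determinant.det] eq_matI)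
  moreover have "fdet (Suc n) (\<lambda>i j. if i = n then r j else F i j) = (\<Sum>j<Suc n. c j * r j)" for r
  proof -
    let ?A = "Matrix.mat (Suc n) (Suc n) (\<lambda>(i, j). if i = n then r j else F i j)"
    have "mat_delete ?A n j = mat_delete (Matrix.mat (Suc n) (Suc n) (\<lambda>(i, j). F i j)) n j" for j
      unfolding mat_delete_def by (rule eq_matI) auto
    then have "cofactor ?A n j = c j" for j
      by (simp only: c_def cofactor_def)
    moreover have "?A $$ (n, j) = r j" if "j < Suc n" for j
      using that by simp
    ultimately show ?thesis
      by (subst laplace_expansion_row[of _ "Suc n" n]) (simp_all add: mult.commute)
  qed
  ultimately show ?thesis by (intro that allI)
qed

text \<open>Every Leibniz term meets each row and each column exactly once, so all terms carry the
  same scaling factor.\<close>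

lemma fdet_scale:
  "fdet n (\<lambda>i j. a i * b j * F i j) = (\<Prod>i<n. a i) * (\<Prod>j<n. b j) * fdet n F"
proof -
  have *: "(\<Prod>i=0..<n. a i * b (\<pi> i) * F i (\<pi> i)) =
      (\<Prod>i<n. a i) * (\<Prod>j<n. b j) * (\<Prod>i=0..<n. F i (\<pi> i))" if "\<pi> permutes {0..<n}" for \<pi>
  proof -
    have "(\<Prod>i=0..<n. b (\<pi> i)) = (\<Prod>j=0..<n. b j)"
      using prod.permute[OF that, of b] by (simp add: o_def)
    then show ?thesis by (simp add: prod.distrib atLeast0LessThan)
  qed
  show ?thesis
    unfolding fdet_leibniz sum_distrib_left
    by (intro sum.cong refl) (simp add: *)
qed

section \<open>The Cauchy-Binet formula\<close>

text \<open>Multilinearity in the rows: a choice function \<open>f\<close> picks one summand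
  \<open>f a\<close> for each row \<open>a\<close>.\<close>

lemma fdet_expand_rows:
  assumes "finite I"
  shows "fdet n (\<lambda>a b. \<Sum>i\<in>I. P a i * Q i b) =
    (\<Sum>f\<in>{0..<n} \<rightarrow>\<^sub>E I. (\<Prod>a=0..<n. P a (f a)) * fdet n (\<lambda>a b. Q (f a) b))"
proof -
  let ?E = "{0..<n} \<rightarrow>\<^sub>E I" and ?S = "{\<pi>. \<pi> permutes {0..<n}}"
  have "fdet n (\<lambda>a b. \<Sum>i\<in>I. P a i * Q i b) =
      (\<Sum>\<pi>\<in>?S. \<Sum>f\<in>?E. signof \<pi> * (\<Prod>a=0..<n. P a (f a) * Q (f a) (\<pi> a)))"
    using assms by (simp only: fdet_leibniz prod_sum_PiE finite_atLeastLessThan sum_distrib_left)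
  also have "\<dots> = (\<Sum>f\<in>?E. \<Sum>\<pi>\<in>?S. signof \<pi> * (\<Prod>a=0..<n. P a (f a) * Q (f a) (\<pi> a)))"
    by (rule sum.swap)
  also have "\<dots> = (\<Sum>f\<in>?E. (\<Prod>a=0..<n. P a (f a)) * fdet n (\<lambda>a b. Q (f a) b))"
    by (simp only: fdet_leibniz sum_distrib_left prod.distrib mult.left_commute)
  finally show ?thesis .
qed

text \<open>Symmetrised Cauchy--Binet: summing over all index functions instead of index sets costs a
  factor \<open>n!\<close> but needs no choice of representatives.\<close>

lemma fdet_cauchy_binet:
  assumes I: "finite I"
  shows "fact n * fdet n (\<lambda>a b. \<Sum>i\<in>I. P a i * Q i b) =
    (\<Sum>f\<in>{0..<n} \<rightarrow>\<^sub>E I. fdet n (\<lambda>a b. P a (f b)) * fdet n (\<lambda>a b. Q (f a) b))"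
proof -
  let ?E = "{0..<n} \<rightarrow>\<^sub>E I" and ?S = "{\<pi>. \<pi> permutes {0..<n}}"
  \<comment> \<open>Reindexing by \<open>f \<circ> \<pi>\<close> permutes the rows of the second
    determinant and so produces the sign of \<open>\<pi>\<close>. Hence every one of the
    \<open>n!\<close> permutations contributes the whole determinant of the product.\<close>
  have *: "(\<Sum>f\<in>?E. signof \<pi> * (\<Prod>a=0..<n. P a (f (\<pi> a))) * fdet n (\<lambda>a b. Q (f a) b)) =
      fdet n (\<lambda>a b. \<Sum>i\<in>I. P a i * Q i b)" if \<pi>: "\<pi> \<in> ?S" for \<pi>
  proof -
    have p: "\<pi> permutes {0..<n}" using \<pi> by simp
    note q = permutes_inv[OF p]
    have m: "\<sigma> i < n \<longleftrightarrow> i < n" if "\<sigma> permutes {0..<n}" for \<sigma> i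
      using permutes_in_image[OF that, of i] by simp
    have "fdet n (\<lambda>a b. \<Sum>i\<in>I. P a i * Q i b) =
        (\<Sum>f\<in>?E. (\<Prod>a=0..<n. P a (f a)) * fdet n (\<lambda>a b. Q (f a) b))"
      by (rule fdet_expand_rows[OF I])
    also have "\<dots> = (\<Sum>f\<in>?E. (\<Prod>a=0..<n. P a (f (\<pi> a))) * fdet n (\<lambda>a b. Q (f (\<pi> a)) b))"
      by (rule sum.reindex_bij_witness[where i = "\<lambda>f. f \<circ> \<pi>" and j = "\<lambda>f. f \<circ> Hilbert_Choice.inv \<pi>"])
         (auto simp: fun_eq_iff permutes_inverses[OF p] PiE_iff extensional_def m[OF p] m[OF q])
    also have "\<dots> = (\<Sum>f\<in>?E. signof \<pi> * (\<Prod>a=0..<n. P a (f (\<pi> a))) * fdet n (\<lambda>a b. Q (f a) b))"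
      by (intro sum.cong refl) (simp add: fdet_permute_rows[OF p, of "\<lambda>a. Q (f a)" for f])
    finally show ?thesis by simp
  qed
  have "(\<Sum>f\<in>?E. fdet n (\<lambda>a b. P a (f b)) * fdet n (\<lambda>a b. Q (f a) b)) =
      (\<Sum>\<pi>\<in>?S. \<Sum>f\<in>?E. signof \<pi> * (\<Prod>a=0..<n. P a (f (\<pi> a))) * fdet n (\<lambda>a b. Q (f a) b))"
    by (subst sum.swap) (simp add: fdet_leibniz[of n "\<lambda>a b. P a (_ b)"] sum_distrib_right)
  also have "\<dots> = (\<Sum>\<pi>\<in>?S. fdet n (\<lambda>a b. \<Sum>i\<in>I. P a i * Q i b))"
    by (rule sum.cong[OF refl *])
  also have "\<dots> = fact n * fdet n (\<lambda>a b. \<Sum>i\<in>I. P a i * Q i b)"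
    by (simp add: card_permutations[of "{0..<n}" n])
  finally show ?thesis by simp
qed

section \<open>Strict total positivity of the exponential kernel\<close>

text \<open>Rolle's theorem with induction on the number of terms. Dividing by the exponential of
  \<open>k0\<close> makes that term constant, so the derivative has one term fewer, and it vanishes
  between any two consecutive zeros.\<close>

lemma exponential_sum_zeros:
  fixes t c :: "'a \<Rightarrow> real"
  assumes "finite I" "inj_on t I" "strict_mono_on {..<card I} z"
    and "\<And>i. i < card I \<Longrightarrow> (\<Sum>k\<in>I. c k * exp (t k * z i)) = 0"
  shows "\<forall>k\<in>I. c k = 0"
  using assms
proof (induction I arbitrary: t c z rule: finite_induct)
  case empty
  then show ?case by simp
next
  case (insert k0 I)
  let ?n = "card I"
  define G where "G y = (\<Sum>k\<in>insert k0 I. c k * exp ((t k - t k0) * y))" for y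
  define G' where "G' y = (\<Sum>k\<in>I. (c k * (t k - t k0)) * exp ((t k - t k0) * y))" for y
  have card: "card (insert k0 I) = Suc ?n" using insert.hyps by simp
  have G0: "G (z i) = 0" if "i < Suc ?n" for i
  proof -
    have "G (z i) = exp (- (t k0 * z i)) * (\<Sum>k\<in>insert k0 I. c k * exp (t k * z i))"
      unfolding G_def sum_distrib_left
      by (intro sum.cong refl) (simp add: algebra_simps exp_diff exp_minus field_simps)
    then show ?thesis using insert.prems(3)[of i] that card by simp
  qed
  have deriv: "(G has_real_derivative G' y) (at y)" for y
  proof -
    have "(G has_real_derivative
        (\<Sum>k\<in>insert k0 I. (c k * (t k - t k0)) * exp ((t k - t k0) * y))) (at y)"
      unfolding G_def by (rule derivative_eq_intros refl | simp add: mult_ac)+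
    then show ?thesis using insert.hyps by (simp add: G'_def)
  qed
  have zmono: "z i < z j" if "i < j" "j < Suc ?n" for i j
    using insert.prems(2) that card by (auto simp: strict_mono_on_def)
  have "\<exists>\<xi>. z i < \<xi> \<and> \<xi> < z (Suc i) \<and> G' \<xi> = 0" if "i < ?n" for i
  proof -
    have "\<exists>\<xi>>z i. \<xi> < z (Suc i) \<and> G (z (Suc i)) - G (z i) = (z (Suc i) - z i) * G' \<xi>"
      using deriv zmono[of i "Suc i"] that by (intro MVT2) auto
    then show ?thesis using G0[of i] G0[of "Suc i"] zmono[of i "Suc i"] that by auto
  qed
  then obtain \<xi> where \<xi>: "\<And>i. i < ?n \<Longrightarrow> z i < \<xi> i \<and> \<xi> i < z (Suc i) \<and> G' (\<xi> i) = 0"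
    by metis
  have "strict_mono_on {..<?n} \<xi>"
  proof (rule strict_mono_onI)
    fix i j assume "i \<in> {..<?n}" "j \<in> {..<?n}" "i < j"
    then have "z (Suc i) \<le> z j" using zmono[of "Suc i" j] by (cases "Suc i = j") auto
    then show "\<xi> i < \<xi> j" using \<xi>[of i] \<xi>[of j] \<open>i \<in> _\<close> \<open>j \<in> _\<close> by auto
  qed
  moreover have "inj_on (\<lambda>k. t k - t k0) I"
    using insert.prems(1) by (auto simp: inj_on_def)
  ultimately have "\<forall>k\<in>I. c k * (t k - t k0) = 0"
    using \<xi> by (intro insert.IH) (auto simp: G'_def)
  \<comment> \<open>As the exponents are distinct, the factors left by differentiation cancel. What
    remains of \<open>G\<close> is the constant \<open>c k0\<close>, which its zero at
    \<open>z 0\<close> forces to vanish.\<close>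
  moreover have "t k \<noteq> t k0" if "k \<in> I" for k
    using insert.prems(1) insert.hyps that by (auto simp: inj_on_def)
  ultimately have cI: "\<forall>k\<in>I. c k = 0" by auto
  then have "c k0 = 0" using G0[of 0] insert.hyps by (simp add: G_def)
  then show ?case using cI by simp
qed

text \<open>Induction on the order. With its last row point replaced by a variable \<open>y\<close>,
  the determinant is an exponential sum \<open>F\<close> whose leading coefficient is the smaller
  determinant and which vanishes at all earlier points. It is positive far to the right, and a sign
  change beyond \<open>x n\<close> would be one zero too many.\<close>

lemma exp_kernel_det_pos:
  assumes "strict_mono_on {..<n} x" "strict_mono_on {..<n} t"
  shows "0 < fdet n (\<lambda>i j. exp (x i * t j))"
  using assms
proof (induction n)
  case 0
  then show ?case by simp
next
  case (Suc n)
  have mono: "strict_mono_on {..<n} x" "strict_mono_on {..<n} t"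
    using Suc.prems by (auto simp: strict_mono_on_def)
  obtain c where cn: "c n = fdet n (\<lambda>i j. exp (x i * t j))"
    and c: "\<forall>r. fdet (Suc n) (\<lambda>i j. if i = n then r j else exp (x i * t j)) = (\<Sum>j<Suc n. c j * r j)"
    by (rule fdet_laplace_last_row[of n "\<lambda>i j. exp (x i * t j)"]) (erule (1) that)
  have cpos: "c n > 0" using Suc.IH mono cn by simp
  define F where "F y = (\<Sum>j<Suc n. c j * exp (t j * y))" for y
  have F: "fdet (Suc n) (\<lambda>i j. if i = n then exp (t j * y) else exp (x i * t j)) = F y" for y
    by (simp only: c[rule_format] F_def)
  have F0: "F (x i) = 0" if "i < n" for i
    using that by (subst F[symmetric], intro fdet_identical_rows[of i _ n]) (auto simp: mult.commute)
  \<comment> \<open>Division by the fastest growing exponential, that of \<open>t n\<close>, leaves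
    only \<open>c n\<close> in the limit.\<close>
  have "((\<lambda>y. \<Sum>j<Suc n. c j * exp ((t j - t n) * y)) \<longlongrightarrow>
      (\<Sum>j<Suc n. c j * (if j = n then 1 else 0))) at_top"
  proof (intro tendsto_sum tendsto_mult tendsto_const)
    fix j assume j: "j \<in> {..<Suc n}"
    show "((\<lambda>y. exp ((t j - t n) * y)) \<longlongrightarrow> (if j = n then 1 else 0)) at_top"
    proof (cases "j = n")
      case False
      then have "t j - t n < 0"
        using Suc.prems(2) j by (auto simp: strict_mono_on_def)
      then have "((\<lambda>y. exp ((t j - t n) * y)) \<longlongrightarrow> 0) at_top" by real_asymp
      then show ?thesis using False by simp
    qed simp
  qed
  then have "((\<lambda>y. \<Sum>j<Suc n. c j * exp ((t j - t n) * y)) \<longlongrightarrow> c n) at_top"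
    by (simp add: if_distrib sum.If_cases cong: if_cong)
  then have "eventually (\<lambda>y. (\<Sum>j<Suc n. c j * exp ((t j - t n) * y)) > 0) at_top"
    using cpos by (rule order_tendstoD)
  then obtain y where y: "y > x n" "(\<Sum>j<Suc n. c j * exp ((t j - t n) * y)) > 0"
    using eventually_conj[OF _ eventually_gt_at_top[of "x n"]] eventually_happens[of _ "at_top :: real filter"]
    by (metis (no_types, lifting) trivial_limit_at_top_linorder)
  have "F y = exp (t n * y) * (\<Sum>j<Suc n. c j * exp ((t j - t n) * y))"
    unfolding F_def sum_distrib_left
    by (intro sum.cong refl) (simp add: algebra_simps exp_diff)
  then have Fy: "F y > 0" using y by simp
  \<comment> \<open>Otherwise the intermediate value theorem gives a zero \<open>w\<close> at or
    beyond \<open>x n\<close>. Together with the \<open>n\<close> earlier points this makes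
    \<open>Suc n\<close> zeros of a sum of \<open>Suc n\<close> exponentials, against
    \<open>c n > 0\<close>.\<close>
  have "F (x n) > 0"
  proof (rule ccontr)
    assume "\<not> F (x n) > 0"
    moreover have "continuous_on {x n..y} F" unfolding F_def by (intro continuous_intros)
    ultimately obtain w where w: "x n \<le> w" "F w = 0"
      using IVT'[of F "x n" 0 y] Fy y(1) by auto
    have "strict_mono_on {..<Suc n} (x(n := w))"
      using Suc.prems(1) w(1) by (force simp: strict_mono_on_def less_Suc_eq)
    moreover have "inj_on t {..<Suc n}"
      using Suc.prems(2) by (rule strict_mono_on_imp_inj_on)
    moreover have "F ((x(n := w)) i) = 0" if "i < Suc n" for i
      using that F0 w(2) by (cases "i = n") auto
    ultimately have "\<forall>k\<in>{..<Suc n}. c k = 0"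
      by (intro exponential_sum_zeros[where z = "x(n := w)" and t = t]) (auto simp: F_def)
    then show False using cpos by simp
  qed
  also have "F (x n) = fdet (Suc n) (\<lambda>i j. exp (x i * t j))"
    by (subst F[symmetric]) (auto intro!: fdet_cong simp: mult.commute)
  finally show ?case .
qed

section \<open>Products of matrices with nonnegative minors\<close>

text \<open>The permutation is the increasing enumeration \<open>g\<close> of the image followed by
  the inverse of \<open>f\<close>. It serves to reduce minors at arbitrary index functions to minors
  at increasing ones.\<close>

lemma obtain_sorting_permutation:
  fixes f :: "nat \<Rightarrow> nat"
  assumes "inj_on f {..<n}"
  obtains \<pi> where "\<pi> permutes {0..<n}" "strict_mono_on {..<n} (\<lambda>i. f (\<pi> i))"
proof -
  let ?A = "f ` {..<n}"
  obtain g where g: "bij_betw g {..<n} ?A" and g_mono: "strict_mono_on {..<n} g"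
    using ex_bij_betw_strict_mono_card[of ?A] card_image[OF assms] by auto
  define \<pi> where "\<pi> i = (if i < n then inv_into {..<n} f (g i) else i)" for i
  have "bij_betw (\<lambda>i. inv_into {..<n} f (g i)) {..<n} {..<n}"
    using bij_betw_trans[OF g bij_betw_inv_into[OF inj_on_imp_bij_betw[OF assms]]]
    by (simp add: o_def)
  then have "bij_betw \<pi> {0..<n} {0..<n}"
    unfolding atLeast0LessThan by (rule bij_betw_cong[THEN iffD1, rotated]) (simp add: \<pi>_def)
  then have "\<pi> permutes {0..<n}"
    by (rule bij_imp_permutes) (simp add: \<pi>_def)
  moreover have "strict_mono_on {..<n} (\<lambda>i. f (\<pi> i))"
  proof (rule strict_mono_onI)
    fix i j assume ij: "i \<in> {..<n}" "j \<in> {..<n}" "i < j"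
    have "f (\<pi> k) = g k" if "k < n" for k
      using that bij_betwE[OF g] by (auto simp: \<pi>_def f_inv_into_f)
    moreover have "g i < g j"
      using g_mono ij by (simp add: strict_mono_on_def)
    ultimately show "f (\<pi> i) < f (\<pi> j)" using ij by simp
  qed
  ultimately show ?thesis by (rule that)
qed

text \<open>Every term of the symmetrised Cauchy-Binet sum is nonnegative: a non-injective
  \<open>f\<close> repeats a row, and sorting an injective \<open>f\<close> changes both minors by
  the same sign. Thus a single positive term makes the sum positive.\<close>

lemma
  fixes P Q :: "nat \<Rightarrow> nat \<Rightarrow> real" and I :: "nat set"
  assumes I: "finite I"
    and P: "\<And>f. strict_mono_on {..<n} f \<Longrightarrow> f ` {..<n} \<subseteq> I \<Longrightarrow> 0 \<le> fdet n (\<lambda>a b. P a (f b))"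
    and Q: "\<And>f. strict_mono_on {..<n} f \<Longrightarrow> f ` {..<n} \<subseteq> I \<Longrightarrow> 0 \<le> fdet n (\<lambda>a b. Q (f a) b)"
  shows fdet_product_nonneg: "0 \<le> fdet n (\<lambda>a b. \<Sum>i\<in>I. P a i * Q i b)"
    and fdet_product_pos: "\<lbrakk>g ` {..<n} \<subseteq> I; 0 < fdet n (\<lambda>a b. P a (g b)); 0 < fdet n (\<lambda>a b. Q (g a) b)\<rbrakk>
      \<Longrightarrow> 0 < fdet n (\<lambda>a b. \<Sum>i\<in>I. P a i * Q i b)"
proof -
  let ?T = "\<lambda>f. fdet n (\<lambda>a b. P a (f b)) * fdet n (\<lambda>a b. Q (f a) b)"
  let ?E = "{0..<n} \<rightarrow>\<^sub>E I"
  have fin: "finite ?E" using I by (intro finite_PiE) auto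
  have nonneg: "0 \<le> ?T f" if f: "f \<in> ?E" for f
  proof (cases "inj_on f {..<n}")
    case True
    then obtain \<pi> where \<pi>: "\<pi> permutes {0..<n}" and mono: "strict_mono_on {..<n} (\<lambda>i. f (\<pi> i))"
      by (rule obtain_sorting_permutation)
    have "(\<lambda>i. f (\<pi> i)) ` {..<n} \<subseteq> I"
      using f permutes_in_image[OF \<pi>] by fastforce
    then have "0 \<le> ?T (\<lambda>i. f (\<pi> i))"
      using P[OF mono] Q[OF mono] by simp
    also have "fdet n (\<lambda>a b. P a (f (\<pi> b))) = signof \<pi> * fdet n (\<lambda>a b. P a (f b))"
      using fdet_permute_rows[OF \<pi>, of "\<lambda>i j. P j (f i)"]
      by (simp add: fdet_transpose[of n "\<lambda>a b. P a (f (\<pi> b))"] fdet_transpose[of n "\<lambda>a b. P a (f b)"])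
    also have "fdet n (\<lambda>a b. Q (f (\<pi> a)) b) = signof \<pi> * fdet n (\<lambda>a b. Q (f a) b)"
      by (rule fdet_permute_rows[OF \<pi>, of "\<lambda>a. Q (f a)"])
    finally show ?thesis by (simp add: sign_def split: if_splits)
  next
    case False
    then obtain i j where "i < n" "j < n" "i \<noteq> j" "f i = f j" by (auto simp: inj_on_def)
    then have "fdet n (\<lambda>a b. Q (f a) b) = 0"
      by (intro fdet_identical_rows[of i n j]) auto
    then show ?thesis by simp
  qed
  have eq: "fact n * fdet n (\<lambda>a b. \<Sum>i\<in>I. P a i * Q i b) = (\<Sum>f\<in>?E. ?T f)"
    by (rule fdet_cauchy_binet[OF I])
  have "0 \<le> fact n * fdet n (\<lambda>a b. \<Sum>i\<in>I. P a i * Q i b)"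
    unfolding eq by (intro sum_nonneg nonneg)
  then show "0 \<le> fdet n (\<lambda>a b. \<Sum>i\<in>I. P a i * Q i b)"
    using fact_gt_zero[of n, where 'a = real] by (auto simp: zero_le_mult_iff)
  assume g: "g ` {..<n} \<subseteq> I" "0 < fdet n (\<lambda>a b. P a (g b))" "0 < fdet n (\<lambda>a b. Q (g a) b)"
  \<comment> \<open>The sum ranges over extensional functions, so \<open>g\<close> is cut off
    outside \<open>{0..<n}\<close>, which leaves both minors unchanged.\<close>
  define g' where "g' = restrict g {0..<n}"
  have "fdet n (\<lambda>a b. P a (g' b)) = fdet n (\<lambda>a b. P a (g b))"
    "fdet n (\<lambda>a b. Q (g' a) b) = fdet n (\<lambda>a b. Q (g a) b)"
    by (rule fdet_cong; simp add: g'_def)+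
  then have "0 < ?T g'" using g by simp
  moreover have "g' \<in> ?E" using g(1) by (auto simp: g'_def)
  ultimately have "0 < fact n * fdet n (\<lambda>a b. \<Sum>i\<in>I. P a i * Q i b)"
    unfolding eq using fin nonneg by (intro sum_pos2[of _ g'])
  then show "0 < fdet n (\<lambda>a b. \<Sum>i\<in>I. P a i * Q i b)"
    by (simp add: zero_less_mult_iff)
qed

text \<open>Cauchy-Binet is applied twice, first to \<open>A\<close> and \<open>H\<close>, then to
  \<open>G\<close> and their product. Since all minors of \<open>G\<close> and \<open>H\<close> are
  positive, one positive principal minor of \<open>A\<close> is enough.\<close>

lemma fdet_triple_product_pos:
  fixes G A H :: "nat \<Rightarrow> nat \<Rightarrow> real"
  assumes G: "\<And>f. strict_mono_on {..<n} f \<Longrightarrow> f ` {..<n} \<subseteq> {..<N} \<Longrightarrow> 0 < fdet n (\<lambda>a b. G a (f b))"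
    and H: "\<And>f. strict_mono_on {..<n} f \<Longrightarrow> f ` {..<n} \<subseteq> {..<N} \<Longrightarrow> 0 < fdet n (\<lambda>a b. H (f a) b)"
    and A: "\<And>f h. strict_mono_on {..<n} f \<Longrightarrow> f ` {..<n} \<subseteq> {..<N} \<Longrightarrow>
      strict_mono_on {..<n} h \<Longrightarrow> h ` {..<n} \<subseteq> {..<N} \<Longrightarrow> 0 \<le> fdet n (\<lambda>a b. A (f a) (h b))"
    and g: "strict_mono_on {..<n} g" "g ` {..<n} \<subseteq> {..<N}" "0 < fdet n (\<lambda>a b. A (g a) (g b))"
  shows "0 < fdet n (\<lambda>a b. \<Sum>i<N. G a i * (\<Sum>j<N. A i j * H j b))"
proof (rule fdet_product_pos[OF _ _ _ g(2)])
  fix f :: "nat \<Rightarrow> nat" assume f: "strict_mono_on {..<n} f" "f ` {..<n} \<subseteq> {..<N}"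
  show "0 \<le> fdet n (\<lambda>a b. G a (f b))"
    using G[OF f] by (rule less_imp_le)
  show "0 \<le> fdet n (\<lambda>a b. \<Sum>j<N. A (f a) j * H j b)"
    by (rule fdet_product_nonneg[OF _ A[OF f] less_imp_le[OF H]]) simp_all
next
  show "0 < fdet n (\<lambda>a b. G a (g b))"
    by (rule G[OF g(1,2)])
  show "0 < fdet n (\<lambda>a b. \<Sum>j<N. A (g a) j * H j b)"
    by (rule fdet_product_pos[OF _ A[OF g(1,2)] less_imp_le[OF H] g(2,3) H[OF g(1,2)]]) simp_all
qed simp

section \<open>Extensions of totally nonnegative kernels\<close>

lemma fdet_unit_last_row:
  assumes "\<And>j. j < n \<Longrightarrow> F n j = 0" "F n n = 1"
  shows "fdet (Suc n) F = fdet n F"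
proof -
  obtain c where c: "c n = fdet n F"
    "\<forall>r. fdet (Suc n) (\<lambda>i j. if i = n then r j else F i j) = (\<Sum>j<Suc n. c j * r j)"
    by (rule fdet_laplace_last_row[of n F]) (erule (1) that)
  have "fdet (Suc n) F = fdet (Suc n) (\<lambda>i j. if i = n then F n j else F i j)"
    by (rule fdet_cong) auto
  also have "\<dots> = (\<Sum>j<Suc n. c j * F n j)" by (rule c(2)[rule_format])
  also have "\<dots> = fdet n F" using assms c(1) by simp
  finally show ?thesis .
qed

lemma increasing_points_UNIV: "increasing_points UNIV n x \<longleftrightarrow> strict_mono_on {..<n} x"
  by (simp add: increasing_points_def)

text \<open>A point outside \<open>X\<close> or \<open>Y\<close> gives a zero row or column; without
  such a point the minor is one of \<open>K\<close>.\<close>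

lemma TN_zero_extension:
  assumes "TN p X Y K"
  shows "TN p UNIV UNIV (\<lambda>z. if z \<in> X \<times> Y then K z else 0)"
  unfolding TN_def kernel_det_def increasing_points_UNIV
proof (intro ballI allI impI)
  fix n and x y :: "nat \<Rightarrow> real"
  assume n: "n \<in> {1..p}" and x: "strict_mono_on {..<n} x" and y: "strict_mono_on {..<n} y"
  let ?D = "fdet n (\<lambda>i j. if (x i, y j) \<in> X \<times> Y then K (x i, y j) else 0)"
  show "0 \<le> ?D"
  proof (cases "x ` {..<n} \<subseteq> X \<and> y ` {..<n} \<subseteq> Y")
    case True
    then have "?D = fdet n (\<lambda>i j. K (x i, y j))"
      by (intro fdet_cong) auto
    also have "\<dots> \<ge> 0"
      using assms n x y True by (auto simp: TN_def kernel_det_def increasing_points_def)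
    finally show ?thesis .
  next
    case False
    then consider i where "i < n" "x i \<notin> X" | j where "j < n" "y j \<notin> Y" by auto
    then have "?D = 0"
      by cases (auto intro: fdet_zero_row fdet_zero_col)
    then show ?thesis by simp
  qed
qed

text \<open>The block sum of \<open>K\<close> on the points up to \<open>c\<close> and the identity
  kernel on the points beyond. When the test \<open>x = y\<close> is reached and succeeds, both
  points exceed \<open>c\<close>, so the mixed blocks are zero.\<close>

definition corner_extension :: "real \<Rightarrow> (real \<times> real \<Rightarrow> real) \<Rightarrow> real \<times> real \<Rightarrow> real" where
  "corner_extension c K = (\<lambda>(x, y). if x \<le> c \<and> y \<le> c then K (x, y) else if x = y then 1 else 0)"

text \<open>Only the largest row point and the largest column point matter. If neither exceeds
  \<open>c\<close>, the minor is one of \<open>K\<close>. If they are equal and exceed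
  \<open>c\<close>, the last row is a unit vector and the order drops by one. In the remaining cases
  the larger of the two exceeds \<open>c\<close> and has a zero row or column.\<close>

lemma TN_corner_extension:
  assumes K: "TN p UNIV UNIV K"
  shows "TN p UNIV UNIV (corner_extension c K)"
proof -
  \<comment> \<open>Order 0 is included as the start of the induction, while \<open>TN\<close>
    speaks of orders from 1.\<close>
  have "0 \<le> fdet n (\<lambda>i j. corner_extension c K (x i, y j))"
    if "n \<le> p" "strict_mono_on {..<n} x" "strict_mono_on {..<n} y" for n x y
    using that
  proof (induction n)
    case 0
    then show ?case by simp
  next
    case (Suc n)
    let ?F = "\<lambda>i j. corner_extension c K (x i, y j)"
    have lt: "x i < x n" "y i < y n" if "i < n" for i
      using Suc.prems that by (auto simp: strict_mono_on_def)
    have le: "x i \<le> x n" "y i \<le> y n" if "i < Suc n" for i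
      using lt[of i] that by (cases "i = n"; simp)+
    consider "x n \<le> c" "y n \<le> c" | "x n = y n" "x n > c" | "x n > c" "y n < x n" | "y n > c" "x n < y n"
      by linarith
    then show ?case
    proof cases
      case 1
      then have "x i \<le> c" "y i \<le> c" if "i < Suc n" for i
        using le[OF that] by auto
      then have "fdet (Suc n) ?F = fdet (Suc n) (\<lambda>i j. K (x i, y j))"
        by (intro fdet_cong) (auto simp: corner_extension_def)
      also have "\<dots> \<ge> 0"
        using K Suc.prems by (auto simp: TN_def kernel_det_def increasing_points_UNIV)
      finally show ?thesis .
    next
      case 2
      then have "fdet (Suc n) ?F = fdet n ?F"
        by (intro fdet_unit_last_row) (auto simp: corner_extension_def dest: lt(2))
      also have "\<dots> \<ge> 0"
        using Suc.prems by (intro Suc.IH) (auto simp: strict_mono_on_def)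
      finally show ?thesis .
    next
      case 3
      then have "fdet (Suc n) ?F = 0"
        by (intro fdet_zero_row[of n]) (auto simp: corner_extension_def dest: le(2))
      then show ?thesis by simp
    next
      case 4
      then have "fdet (Suc n) ?F = 0"
        by (intro fdet_zero_col[of n]) (auto simp: corner_extension_def dest: le(1))
      then show ?thesis by simp
    qed
  qed
  then show ?thesis by (auto simp: TN_def kernel_det_def increasing_points_UNIV)
qed

lemma fdet_identity: "fdet n (\<lambda>i j. if i = j then 1 else 0) = 1"
  using det_one[of n] by (simp add: one_mat_def)

section \<open>Normalised Gaussian weights\<close>

text \<open>The denominator makes the weights at each \<open>x\<close> a probability distribution on
  the nodes. It depends on \<open>x\<close> alone, so in minors it only scales rows.\<close>

definition gauss_weight :: "real \<Rightarrow> (nat \<Rightarrow> real) \<Rightarrow> nat \<Rightarrow> real \<Rightarrow> nat \<Rightarrow> real" where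
  "gauss_weight \<sigma> t N x i = exp (- \<sigma> * (x - t i)^2) / (\<Sum>k<N. exp (- \<sigma> * (x - t k)^2))"

lemma gauss_weight_nonneg: "0 \<le> gauss_weight \<sigma> t N x i"
  by (auto simp: gauss_weight_def intro!: divide_nonneg_nonneg sum_nonneg)

lemma gauss_norm_pos:
  fixes t :: "nat \<Rightarrow> real"
  assumes "0 < N"
  shows "0 < (\<Sum>k<N. exp (- \<sigma> * (x - t k)^2))"
  using assms by (intro sum_pos) auto

lemma sum_gauss_weight: "0 < N \<Longrightarrow> (\<Sum>i<N. gauss_weight \<sigma> t N x i) = 1"
  using gauss_norm_pos[of N \<sigma> x t] by (simp add: gauss_weight_def flip: sum_divide_distrib)

text \<open>Expanding the square splits the weight into a positive row factor, a positive column
  factor and an exponential kernel in \<open>2 * \<sigma> * x a\<close> and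
  \<open>s b\<close>.\<close>

lemma gauss_weight_det_pos:
  fixes t :: "nat \<Rightarrow> real"
  assumes "0 < \<sigma>" "0 < N" "strict_mono_on {..<n} x" "strict_mono_on {..<n} s"
  shows "0 < fdet n (\<lambda>a b. exp (- \<sigma> * (x a - s b)^2) / (\<Sum>k<N. exp (- \<sigma> * (x a - t k)^2)))"
proof -
  define A where "A a = exp (- \<sigma> * (x a)^2) / (\<Sum>k<N. exp (- \<sigma> * (x a - t k)^2))" for a
  define B where "B b = exp (- \<sigma> * (s b)^2)" for b
  have "exp (- \<sigma> * (x a - s b)^2) / (\<Sum>k<N. exp (- \<sigma> * (x a - t k)^2)) =
      A a * B b * exp (2 * \<sigma> * x a * s b)" for a b
  proof -
    have "exp (- \<sigma> * (x a - s b)^2) = exp (- \<sigma> * (x a)^2) * exp (- \<sigma> * (s b)^2) * exp (2 * \<sigma> * x a * s b)"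
      by (simp add: power2_eq_square algebra_simps flip: exp_add)
    then show ?thesis by (simp add: A_def B_def)
  qed
  then have "fdet n (\<lambda>a b. exp (- \<sigma> * (x a - s b)^2) / (\<Sum>k<N. exp (- \<sigma> * (x a - t k)^2))) =
      (\<Prod>a<n. A a) * (\<Prod>b<n. B b) * fdet n (\<lambda>a b. exp (2 * \<sigma> * x a * s b))"
    by (simp only: fdet_scale)
  moreover have "0 < (\<Prod>a<n. A a)" "0 < (\<Prod>b<n. B b)"
    using gauss_norm_pos[OF assms(2)] by (auto intro!: prod_pos simp: A_def B_def)
  moreover have "0 < fdet n (\<lambda>a b. exp (2 * \<sigma> * x a * s b))"
    using assms by (intro exp_kernel_det_pos) (auto simp: strict_mono_on_def)
  ultimately show ?thesis by simp
qed

text \<open>The node \<open>i0\<close> alone keeps the denominator above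
  \<open>exp (- \<sigma> * \<rho>^2)\<close>, while a node at distance at least
  \<open>\<eta>\<close> has numerator at most \<open>exp (- \<sigma> * \<eta>^2)\<close>. The bound
  is of interest when \<open>\<rho> < \<eta>\<close>.\<close>

lemma gauss_weight_tail:
  assumes "0 < \<sigma>" "0 \<le> \<eta>" "i0 < N" "\<bar>x - t i0\<bar> \<le> \<rho>"
  shows "(\<Sum>i | i < N \<and> \<eta> \<le> \<bar>x - t i\<bar>. gauss_weight \<sigma> t N x i) \<le> N * exp (\<sigma> * (\<rho>^2 - \<eta>^2))"
proof -
  have "gauss_weight \<sigma> t N x i \<le> exp (\<sigma> * (\<rho>^2 - \<eta>^2))" if "\<eta> \<le> \<bar>x - t i\<bar>" for i
  proof -
    have *: "\<eta>^2 \<le> (x - t i)^2"  "(x - t i0)^2 \<le> \<rho>^2"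
      using that assms abs_le_square_iff[of \<eta> "x - t i"] abs_le_square_iff[of "x - t i0" \<rho>] by auto
    have "gauss_weight \<sigma> t N x i \<le> exp (- \<sigma> * \<eta>^2) / exp (- \<sigma> * \<rho>^2)"
      unfolding gauss_weight_def
    proof (rule frac_le)
      have "exp (- \<sigma> * \<rho>^2) \<le> exp (- \<sigma> * (x - t i0)^2)" using * assms by simp
      also have "\<dots> \<le> (\<Sum>k<N. exp (- \<sigma> * (x - t k)^2))"
        using assms by (intro member_le_sum) auto
      finally show "exp (- \<sigma> * \<rho>^2) \<le> (\<Sum>k<N. exp (- \<sigma> * (x - t k)^2))" .
    qed (use * assms in auto)
    also have "\<dots> = exp (\<sigma> * (\<rho>^2 - \<eta>^2))"
      by (simp add: algebra_simps flip: exp_diff)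
    finally show ?thesis .
  qed
  then have "(\<Sum>i | i < N \<and> \<eta> \<le> \<bar>x - t i\<bar>. gauss_weight \<sigma> t N x i) \<le>
      card {i. i < N \<and> \<eta> \<le> \<bar>x - t i\<bar>} * exp (\<sigma> * (\<rho>^2 - \<eta>^2))"
    by (intro sum_bounded_above) auto
  also have "\<dots> \<le> N * exp (\<sigma> * (\<rho>^2 - \<eta>^2))"
  proof (intro mult_right_mono of_nat_mono)
    show "card {i. i < N \<and> \<eta> \<le> \<bar>x - t i\<bar>} \<le> N"
      using card_mono[of "{..<N}" "{i. i < N \<and> \<eta> \<le> \<bar>x - t i\<bar>}"] by auto
  qed simp
  finally show ?thesis .
qed

section \<open>Smoothing of a sampled kernel\<close>

text \<open>A product of three matrices: the weights at \<open>x\<close>, the samples of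
  \<open>K\<close>, and the transposed weights at \<open>y\<close>. The nested form of the sum is
  the one to which Cauchy-Binet applies factor by factor.\<close>

definition smoothing :: "real \<Rightarrow> (nat \<Rightarrow> real) \<Rightarrow> nat \<Rightarrow> (real \<times> real \<Rightarrow> real) \<Rightarrow> real \<times> real \<Rightarrow> real" where
  "smoothing \<sigma> t N K = (\<lambda>(x, y). \<Sum>i<N. gauss_weight \<sigma> t N x i *
     (\<Sum>j<N. K (t i, t j) * gauss_weight \<sigma> t N y j))"

text \<open>From index \<open>m\<close> on all nodes exceed \<open>c\<close>, and at least
  \<open>p\<close> of them are in use. This leaves room for an identity minor of every order up to
  \<open>p\<close>, the one positive minor that the triple product asks for.\<close>

lemma TP_smoothing_corner_extension:
  assumes "0 < \<sigma>" and t: "strict_mono t" and K: "TN p UNIV UNIV K" and m: "c < t m" "m + p \<le> N"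
  shows "TP p UNIV UNIV (smoothing \<sigma> t N (corner_extension c K))"
  unfolding TP_def kernel_det_def increasing_points_UNIV
proof (intro ballI allI impI)
  fix n and x y :: "nat \<Rightarrow> real"
  assume n: "n \<in> {1..p}" and x: "strict_mono_on {..<n} x" and y: "strict_mono_on {..<n} y"
  have N: "0 < N" using n m by auto
  have mono_t: "strict_mono_on {..<n} (\<lambda>i. t (f i))" if "strict_mono_on {..<n} f" for f :: "nat \<Rightarrow> nat"
    using that t by (auto simp: strict_mono_on_def strict_mono_def)
  let ?A = "\<lambda>i j. corner_extension c K (t i, t j)"
  have "0 < fdet n (\<lambda>a b. \<Sum>i<N. gauss_weight \<sigma> t N (x a) i *
      (\<Sum>j<N. ?A i j * gauss_weight \<sigma> t N (y b) j))"
  proof (rule fdet_triple_product_pos)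
    fix f :: "nat \<Rightarrow> nat" assume f: "strict_mono_on {..<n} f"
    show "0 < fdet n (\<lambda>a b. gauss_weight \<sigma> t N (x a) (f b))"
      using gauss_weight_det_pos[OF \<open>0 < \<sigma>\<close> N x mono_t[OF f]] by (simp add: gauss_weight_def)
    show "0 < fdet n (\<lambda>a b. gauss_weight \<sigma> t N (y b) (f a))"
      using gauss_weight_det_pos[OF \<open>0 < \<sigma>\<close> N y mono_t[OF f]]
      by (subst fdet_transpose[symmetric]) (simp add: gauss_weight_def)
    fix h :: "nat \<Rightarrow> nat" assume h: "strict_mono_on {..<n} h"
    show "0 \<le> fdet n (\<lambda>a b. ?A (f a) (h b))"
      by (rule TN_corner_extension[OF K, of c, unfolded TN_def kernel_det_def increasing_points_UNIV,
            rule_format, OF n mono_t[OF f] mono_t[OF h]])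
  next
    show "strict_mono_on {..<n} (\<lambda>i. m + i)" by (auto simp: strict_mono_on_def)
    show "(\<lambda>i. m + i) ` {..<n} \<subseteq> {..<N}" using m n by auto
    have "c < t (m + i)" for i
      using m(1) strict_mono_less_eq[OF t, of m "m + i"] by simp
    then have "\<not> t (m + i) \<le> c" for i by (simp add: not_le)
    then have "?A (m + a) (m + b) = (if a = b then 1 else 0)" for a b
      using strict_mono_eq[OF t] by (simp add: corner_extension_def)
    then show "0 < fdet n (\<lambda>a b. ?A (m + a) (m + b))"
      by (simp add: fdet_identity)
  qed
  then show "0 < fdet n (\<lambda>i j. smoothing \<sigma> t N (corner_extension c K) (x i, y j))"
    by (simp only: smoothing_def prod.case)
qed

text \<open>Interchanging the two sums swaps the roles of the weights at \<open>x\<close> and at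
  \<open>y\<close>.\<close>

lemma smoothing_symmetric:
  assumes "\<And>x y. K (x, y) = K (y, x)"
  shows "smoothing \<sigma> t N K (x, y) = smoothing \<sigma> t N K (y, x)"
proof -
  let ?w = "gauss_weight \<sigma> t N"
  have "?w x i * (K (t i, t j) * ?w y j) = ?w y j * (K (t j, t i) * ?w x i)" for i j
    using assms[of "t i" "t j"] by simp
  then have "smoothing \<sigma> t N K (x, y) = (\<Sum>i<N. \<Sum>j<N. ?w y j * (K (t j, t i) * ?w x i))"
    by (simp only: smoothing_def prod.case sum_distrib_left)
  also have "\<dots> = (\<Sum>j<N. \<Sum>i<N. ?w y j * (K (t j, t i) * ?w x i))"
    by (rule sum.swap)
  finally show ?thesis
    by (simp only: smoothing_def prod.case sum_distrib_left)
qed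

section \<open>Error of a weighted average and uniform continuity near a compact set\<close>

text \<open>\<open>P\<close> and \<open>Q\<close> mark the indices of far nodes. Pairs of near nodes
  err by at most \<open>\<epsilon>\<close>; any other pair errs by at most \<open>B\<close> and is
  charged to the weight of a far index.\<close>

lemma average_error:
  fixes w w' :: "nat \<Rightarrow> real"
  assumes w: "\<And>i. 0 \<le> w i" "(\<Sum>i<N. w i) = 1" and w': "\<And>i. 0 \<le> w' i" "(\<Sum>i<N. w' i) = 1"
    and B: "\<And>i j. \<bar>A i j - v\<bar> \<le> B"
    and \<epsilon>: "0 \<le> \<epsilon>" "\<And>i j. \<not> P i \<Longrightarrow> \<not> Q j \<Longrightarrow> \<bar>A i j - v\<bar> \<le> \<epsilon>"
  shows "\<bar>(\<Sum>i<N. w i * (\<Sum>j<N. A i j * w' j)) - v\<bar> \<le>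
    \<epsilon> + B * (\<Sum>i | i < N \<and> P i. w i) + B * (\<Sum>j | j < N \<and> Q j. w' j)"
proof -
  have fin: "(\<Sum>i | i < N \<and> R i. u i) = (\<Sum>i<N. of_bool (R i) * u i)" for R and u :: "nat \<Rightarrow> real"
    by (rule sum.mono_neutral_cong_left) auto
  have avg: "(\<Sum>i<N. (c + B * of_bool (R i)) * u i) = c + B * (\<Sum>i<N. of_bool (R i) * u i)"
    if "(\<Sum>i<N. u i) = 1" for c R and u :: "nat \<Rightarrow> real"
    using that by (simp only: distrib_right sum.distrib mult.assoc sum_distrib_left[symmetric] mult_1_right)
  have "B \<ge> 0" using B[of 0 0] by simp
  have "(\<Sum>i<N. w i * (\<Sum>j<N. A i j * w' j)) - v =
      (\<Sum>i<N. w i * (\<Sum>j<N. A i j * w' j)) - (\<Sum>i<N. w i * (\<Sum>j<N. v * w' j))"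
    using w w' by (simp flip: sum_distrib_left sum_distrib_right)
  also have "\<dots> = (\<Sum>i<N. w i * (\<Sum>j<N. (A i j - v) * w' j))"
    by (simp add: sum_subtractf left_diff_distrib right_diff_distrib)
  also have "\<bar>\<dots>\<bar> \<le> (\<Sum>i<N. w i * (\<Sum>j<N. \<bar>A i j - v\<bar> * w' j))"
    by (intro order_trans[OF sum_abs] sum_mono)
       (auto simp: abs_mult w w' intro!: mult_left_mono order_trans[OF sum_abs] sum_mono)
  \<comment> \<open>The pointwise bound is a sum of a constant, a term in \<open>i\<close> and a
    term in \<open>j\<close>, so the two averages can be evaluated one after the other.\<close>
  also have "\<dots> \<le> (\<Sum>i<N. w i * (\<Sum>j<N. (\<epsilon> + B * of_bool (P i) + B * of_bool (Q j)) * w' j))"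
  proof (intro sum_mono mult_left_mono mult_right_mono w w')
    fix i j
    show "\<bar>A i j - v\<bar> \<le> \<epsilon> + B * of_bool (P i) + B * of_bool (Q j)"
      using B[of i j] \<epsilon>(1) \<epsilon>(2)[of i j] \<open>B \<ge> 0\<close> by (auto simp: of_bool_def)
  qed
  also have "\<dots> = (\<Sum>i<N. ((\<epsilon> + B * (\<Sum>j<N. of_bool (Q j) * w' j)) + B * of_bool (P i)) * w i)"
    unfolding avg[OF w'(2)] by (intro sum.cong refl) (simp add: algebra_simps)
  also have "\<dots> = \<epsilon> + B * (\<Sum>i<N. of_bool (P i) * w i) + B * (\<Sum>j<N. of_bool (Q j) * w' j)"
    unfolding avg[OF w(2)] by simp
  also have "\<dots> = \<epsilon> + B * (\<Sum>i | i < N \<and> P i. w i) + B * (\<Sum>j | j < N \<and> Q j. w' j)"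
    by (simp only: fin)
  finally show ?thesis .
qed

text \<open>Stronger than uniform continuity on \<open>S\<close>: the point \<open>z'\<close> may
  lie outside \<open>S\<close>, as grid points near \<open>S\<close> do. The radius is a Lebesgue
  number of the cover of \<open>S\<close> by open sets on which values of \<open>K\<close> differ by
  less than \<open>\<epsilon>\<close>.\<close>

lemma compact_uniform_modulus:
  fixes K :: "'a::metric_space \<Rightarrow> 'b::metric_space"
  assumes S: "compact S" and cont: "\<And>z. z \<in> S \<Longrightarrow> isCont K z" and "0 < \<epsilon>"
  obtains \<delta> where "0 < \<delta>" "\<And>z z'. z \<in> S \<Longrightarrow> dist z' z < \<delta> \<Longrightarrow> dist (K z') (K z) < \<epsilon>"
proof -
  define G where "G = {U. open U \<and> (\<forall>u\<in>U. \<forall>v\<in>U. dist (K u) (K v) < \<epsilon>)}"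
  have "S \<subseteq> \<Union>G"
  proof
    fix z assume "z \<in> S"
    from cont[OF this, unfolded continuous_at_eps_delta, rule_format, OF half_gt_zero[OF \<open>0 < \<epsilon>\<close>]]
    obtain d where d: "d > 0" "\<forall>z'. dist z' z < d \<longrightarrow> dist (K z') (K z) < \<epsilon> / 2"
      by (elim exE conjE)
    have "dist (K u) (K z) < \<epsilon> / 2" if "u \<in> ball z d" for u
      using d(2)[rule_format, of u] that by (simp add: dist_commute)
    from dist_triangle_half_l[OF this this]
    have "ball z d \<in> G" by (simp add: G_def)
    then show "z \<in> \<Union>G" using d(1) by (intro UnionI[of "ball z d"]) simp_all
  qed
  have "\<exists>\<delta>>0. \<forall>z\<in>S. \<exists>U\<in>G. ball z \<delta> \<subseteq> U"
  proof (rule Heine_Borel_lemma[OF S \<open>S \<subseteq> \<Union>G\<close>])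
    show "open U" if "U \<in> G" for U
      using that by (simp add: G_def)
    fix \<delta> :: real assume "0 < \<delta>" "\<And>z. z \<in> S \<Longrightarrow> \<exists>U\<in>G. ball z \<delta> \<subseteq> U"
    then show "\<exists>\<delta>>0. \<forall>z\<in>S. \<exists>U\<in>G. ball z \<delta> \<subseteq> U"
      by (intro exI[of _ \<delta>] conjI ballI)
  qed
  then obtain \<delta> where "\<delta> > 0" and \<delta>: "\<forall>z\<in>S. \<exists>U\<in>G. ball z \<delta> \<subseteq> U"
    by (elim exE conjE)
  show ?thesis
  proof (rule that[OF \<open>\<delta> > 0\<close>])
    fix z z' assume "z \<in> S" "dist z' z < \<delta>"
    from bspec[OF \<delta> \<open>z \<in> S\<close>] obtain U where "U \<in> G" "ball z \<delta> \<subseteq> U" by (rule bexE)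
    then have "z \<in> U" "z' \<in> U" using subsetD[of "ball z \<delta>" U] \<open>\<delta> > 0\<close> \<open>dist z' z < \<delta>\<close> dist_commute[of z z'] by auto
    then show "dist (K z') (K z) < \<epsilon>" using \<open>U \<in> G\<close> by (simp add: G_def)
  qed
qed

section \<open>The approximating sequence and its convergence\<close>

text \<open>Nodes of spacing \<open>1 / l\<close> starting at \<open>- l\<close>; for
  \<open>l \<ge> 1\<close> the index \<open>2 * l^2\<close> gives the node \<open>l\<close>.\<close>

definition grid :: "nat \<Rightarrow> nat \<Rightarrow> real" where
  "grid l i = real i / real l - real l"

text \<open>There are \<open>2 * l^2 + 1\<close> nodes from \<open>- l\<close> to \<open>l\<close>
  for sampling \<open>K\<close> and \<open>p\<close> nodes beyond \<open>l\<close> for the identity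
  block. With sharpness \<open>l\<close> the weights at a fixed distance decay exponentially in
  \<open>l\<close>, against quadratically many nodes.\<close>

definition TP_approximation :: "nat \<Rightarrow> (real \<times> real \<Rightarrow> real) \<Rightarrow> nat \<Rightarrow> real \<times> real \<Rightarrow> real" where
  "TP_approximation p K l = smoothing (real l) (grid l) (2 * l^2 + 1 + p) (corner_extension (real l) K)"

lemma TP_TP_approximation:
  assumes "TN p UNIV UNIV K" "l \<ge> 1"
  shows "TP p UNIV UNIV (TP_approximation p K l)"
  unfolding TP_approximation_def
\<comment> \<open>The node of index \<open>2 * l^2\<close> is the corner \<open>l\<close> itself, so
  the next index is the first beyond it.\<close>
proof (rule TP_smoothing_corner_extension[where m = "2 * l^2 + 1"])
  show "strict_mono (grid l)"
    using assms by (auto simp: strict_mono_def grid_def divide_strict_right_mono)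
  show "real l < grid l (2 * l^2 + 1)"
    using assms by (simp add: grid_def power2_eq_square field_simps)
qed (use assms in simp_all)

text \<open>Rounding down to the nearest node on the left; the index bound ensures that this node is
  among those of \<open>TP_approximation\<close>.\<close>

lemma grid_dense:
  assumes "l \<ge> 1" "\<bar>x\<bar> \<le> real l"
  obtains i where "i \<le> 2 * l^2" "\<bar>x - grid l i\<bar> \<le> 1 / real l"
proof
  define i where "i = nat \<lfloor>(x + l) * l\<rfloor>"
  have nn: "0 \<le> (x + l) * l" using assms by simp
  have i: "real i \<le> (x + l) * l" "(x + l) * l < real i + 1"
    using nn unfolding i_def by linarith+
  have "(x + l) * l \<le> (2 * real l) * real l"
    using assms by (intro mult_right_mono) auto
  then have "real i \<le> real (2 * l^2)" using i by (simp add: power2_eq_square)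
  then show "i \<le> 2 * l^2" by (simp only: of_nat_le_iff)
  have "grid l i \<le> x" "x \<le> grid l i + 1 / real l"
    using i assms by (simp_all add: grid_def field_simps)
  then show "\<bar>x - grid l i\<bar> \<le> 1 / real l" by simp
qed

text \<open>Near nodes are controlled by the modulus of continuity around \<open>S\<close>, far
  nodes by the Gaussian tail; neither bound depends on the point of \<open>S\<close>.\<close>

lemma uniform_limit_TP_approximation:
  assumes bound: "\<And>z. \<bar>K z\<bar> \<le> M" and S: "compact S" and cont: "\<And>z. z \<in> S \<Longrightarrow> isCont K z"
  shows "uniform_limit S (TP_approximation p K) K sequentially"
proof (rule uniform_limitI)
  fix e :: real assume "0 < e"
  then obtain \<delta> where \<delta>: "0 < \<delta>" "\<And>z z'. z \<in> S \<Longrightarrow> dist z' z < \<delta> \<Longrightarrow> dist (K z') (K z) < e / 2"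
    using compact_uniform_modulus[OF S cont, of "e / 2"] by auto
  \<comment> \<open>Two coordinate errors below \<open>\<eta>\<close> add up to a distance below
    \<open>\<delta>\<close> in the plane.\<close>
  define \<eta> where "\<eta> = \<delta> / 2"
  have \<eta>: "0 < \<eta>" using \<delta> by (simp add: \<eta>_def)
  obtain R where R: "\<And>z. z \<in> S \<Longrightarrow> norm z \<le> R"
    using compact_imp_bounded[OF S] by (auto simp: bounded_iff)
  have "M \<ge> 0" using bound[of "(0, 0)"] by simp
  \<comment> \<open>The extension takes values of \<open>K\<close> or 0 or 1, hence is bounded by
    \<open>M + 1\<close>, and \<open>K z\<close> is bounded by \<open>M\<close>.\<close>
  define B where "B = 2 * M + 1"
  \<comment> \<open>The tail bound for \<open>\<sigma> = l\<close> and
    \<open>\<rho> = 1 / l\<close>, the grid spacing. The exponent is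
    \<open>1 / l - l * \<eta>^2\<close>, so the exponential beats the number of nodes.\<close>
  define T where "T l = real (2 * l^2 + 1 + p) * exp (real l * ((1 / real l)^2 - \<eta>^2))" for l
  have "(\<lambda>l. 2 * B * T l) \<longlonglongrightarrow> 0"
    unfolding T_def using \<eta> by real_asymp
  then have "eventually (\<lambda>l. 2 * B * T l < e / 2) sequentially"
    using \<open>0 < e\<close> by (intro order_tendstoD) auto
  \<comment> \<open>For such \<open>l\<close> the coordinates of points of \<open>S\<close> lie
    within the grid, and nodes closer than \<open>\<eta>\<close> to them are below the corner, where
    the extension equals \<open>K\<close>.\<close>
  moreover have "eventually (\<lambda>l. real l > R + \<eta>) sequentially"
    by real_asymp
  ultimately show "eventually (\<lambda>l. \<forall>z\<in>S. dist (TP_approximation p K l z) (K z) < e) sequentially"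
    using eventually_ge_at_top[of 1]
  proof eventually_elim
    case (elim l)
    show ?case
    proof
      fix z assume z: "z \<in> S"
      obtain x y where xy: "z = (x, y)" by fastforce
      let ?N = "2 * l^2 + 1 + p"
      let ?w = "gauss_weight l (grid l) ?N"
      let ?L = "corner_extension (real l) K"
      let ?far = "\<lambda>x i. \<eta> \<le> \<bar>x - grid l i\<bar>"
      have xR: "\<bar>x\<bar> \<le> R" "\<bar>y\<bar> \<le> R"
        using R[OF z] norm_fst_le[of x y] norm_snd_le[of y x] by (auto simp: xy)
      have tail: "(\<Sum>i | i < ?N \<and> ?far u i. ?w u i) \<le> T l" if u: "\<bar>u\<bar> \<le> R" for u
      proof -
        obtain i where "i \<le> 2 * l^2" "\<bar>u - grid l i\<bar> \<le> 1 / real l"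
          using grid_dense[of l u] u elim \<eta> by auto
        then show ?thesis
          unfolding T_def using elim \<eta> by (intro gauss_weight_tail[of _ _ i]) auto
      qed
      have "\<bar>?L (grid l i, grid l j) - K z\<bar> \<le> B" for i j
        using bound[of z] bound[of "(grid l i, grid l j)"] \<open>M \<ge> 0\<close>
        by (auto simp: corner_extension_def B_def abs_if split: if_splits)
      moreover have "\<bar>?L (grid l i, grid l j) - K z\<bar> \<le> e / 2" if "\<not> ?far x i" "\<not> ?far y j" for i j
      proof -
        have "dist (grid l i, grid l j) (x, y) \<le> \<bar>x - grid l i\<bar> + \<bar>y - grid l j\<bar>"
          unfolding dist_Pair_Pair by (rule order_trans[OF sqrt_sum_squares_le_sum_abs])
            (auto simp: dist_real_def)
        also have "\<dots> < \<delta>" using that by (simp add: \<eta>_def)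
        finally have "dist (K (grid l i, grid l j)) (K z) < e / 2"
          using \<delta>(2)[OF z] by (simp add: xy)
        moreover have "grid l i \<le> l" "grid l j \<le> l" using that xR elim by auto
        ultimately show ?thesis by (simp add: corner_extension_def dist_real_def)
      qed
      ultimately have "\<bar>TP_approximation p K l z - K z\<bar> \<le>
          e / 2 + B * (\<Sum>i | i < ?N \<and> ?far x i. ?w x i) + B * (\<Sum>j | j < ?N \<and> ?far y j. ?w y j)"
        unfolding TP_approximation_def smoothing_def xy prod.case
        by (intro average_error gauss_weight_nonneg sum_gauss_weight) (use \<open>0 < e\<close> in auto)
      also have "\<dots> \<le> e / 2 + B * T l + B * T l"
        using tail[OF xR(1)] tail[OF xR(2)] \<open>M \<ge> 0\<close>
        by (intro add_mono mult_left_mono) (auto simp: B_def)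
      also have "\<dots> < e" using elim by simp
      finally show "dist (TP_approximation p K l z) (K z) < e" by (simp add: dist_real_def)
    qed
  qed
qed

section \<open>Return from the plane to the given domain\<close>

lemma TP_subset:
  assumes "TP p UNIV UNIV K"
  shows "TP p X Y K"
  unfolding TP_def
proof (intro ballI allI impI)
  fix n x y
  assume n: "n \<in> {1..p}" and "increasing_points X n x" "increasing_points Y n y"
  then have "increasing_points UNIV n x" "increasing_points UNIV n y"
    by (simp_all add: increasing_points_def)
  with n show "0 < kernel_det K n x y"
    using assms by (simp add: TP_def)
qed

text \<open>At an interior point, continuity within the product is plain continuity, and the
  extension agrees with \<open>K\<close> on a whole neighbourhood.\<close>

lemma isCont_zero_extension:
  assumes "z \<in> interior_continuity_points X Y K"
  shows "isCont (\<lambda>z. if z \<in> X \<times> Y then K z else 0) z"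
proof -
  have z: "z \<in> interior (X \<times> Y)" and "continuous (at z within X \<times> Y) K"
    using assms unfolding interior_continuity_points_def by blast+
  then have K: "isCont K z" by (simp only: at_within_interior)
  have "eventually (\<lambda>z. z \<in> interior (X \<times> Y)) (nhds z)"
    by (rule eventually_nhds_in_open[OF open_interior z])
  then have "eventually (\<lambda>z. (if z \<in> X \<times> Y then K z else 0) = K z) (nhds z)"
    by (rule eventually_mono) (rule if_P[OF subsetD[OF interior_subset]])
  from isCont_cong[OF this] K show ?thesis by (rule iffD2)
qed

theorem theorem1p2:
  fixes X Y :: "real set" and p :: nat and K :: "real \<times> real \<Rightarrow> real"
  assumes "X \<noteq> {}" and "Y \<noteq> {}" and "p \<ge> 1"
    and "bounded (K ` (X \<times> Y))" and "TN p X Y K"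
  defines "C \<equiv> interior_continuity_points X Y K"
  shows "(\<exists>Ks. (\<forall>l\<ge>1. TP p X Y (Ks l)) \<and> converges_locally_uniformly_on C Ks K)
    \<and> (X = Y \<and> symmetric_kernel X K \<longrightarrow>
        (\<exists>Ks. (\<forall>l\<ge>1. TP p X Y (Ks l) \<and> symmetric_kernel X (Ks l))
           \<and> converges_locally_uniformly_on C Ks K))"
proof -
  define K0 where "K0 z = (if z \<in> X \<times> Y then K z else 0)" for z
  define Ks where "Ks = TP_approximation p K0"
  have K0: "TN p UNIV UNIV K0"
    using TN_zero_extension[OF assms(5)] by (simp add: K0_def[abs_def])
  have TP: "TP p X Y (Ks l)" if "l \<ge> 1" for l
    unfolding Ks_def by (rule TP_subset[OF TP_TP_approximation[OF K0 that]])
  obtain M where "\<And>z. z \<in> X \<times> Y \<Longrightarrow> \<bar>K z\<bar> \<le> M"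
    using assms(4) unfolding bounded_iff by (metis image_eqI real_norm_def)
  \<comment> \<open>The maximum with 0 covers the value 0 off \<open>X \<times> Y\<close>.\<close>
  then have bound: "\<bar>K0 z\<bar> \<le> max M 0" for z
    by (auto simp: K0_def le_max_iff_disj)
  have conv: "converges_locally_uniformly_on C Ks K"
    unfolding converges_locally_uniformly_on_def
  proof (intro allI impI)
    fix S assume S: "compact S \<and> S \<subseteq> C"
    then have "isCont K0 z" if "z \<in> S" for z
      using isCont_zero_extension[of z X Y K] that by (auto simp: K0_def[abs_def] C_def)
    then have "uniform_limit S Ks K0 sequentially"
      unfolding Ks_def using S by (intro uniform_limit_TP_approximation[OF bound]) auto
    moreover have "K0 z = K z" if "z \<in> S" for z
      using S that interior_subset[of "X \<times> Y"]
      by (auto simp: K0_def C_def interior_continuity_points_def)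
    ultimately show "uniform_limit S Ks K sequentially"
      by (metis (no_types, lifting) uniform_limit_cong')
  qed
  \<comment> \<open>The same sequence \<open>Ks\<close> serves both claims, since zero extension,
    corner extension and smoothing all keep symmetry.\<close>
  have "symmetric_kernel X (Ks l)" if "X = Y" "symmetric_kernel X K" for l
  proof -
    have "K0 (x, y) = K0 (y, x)" for x y
      using that by (auto simp: K0_def symmetric_kernel_def)
    then have "corner_extension (real l) K0 (x, y) = corner_extension (real l) K0 (y, x)" for x y
      by (auto simp: corner_extension_def)
    then show ?thesis
      unfolding symmetric_kernel_def Ks_def TP_approximation_def using smoothing_symmetric by blast
  qed
  then show ?thesis using TP conv by blast
qed

end
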